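(* Let $\mathbb F_q$ be a finite field of characteristic $2$, let $n$ be a positive integer, and let $\chi$ be a nontrivial additive character of $\mathbb F_{q^n}$. A polynomial $f$ over $\mathbb F_{q^n}$ is a permutation polynomial of $\mathbb F_{q^n}$ if and only if $\sum_{v\in\mathbb F_{q^n}}\chi(uf(v))=0$ for every $u\in\mathbb F_{q^n}^*$.
   Context: A polynomial over $\mathbb F_{q^n}$ is called a permutation polynomial of $\mathbb F_{q^n}$ if the map $v\mapsto f(v)$ it defines on $\mathbb F_{q^n}$ is a bijection. An additive character of $\mathbb F_{q^n}$ is a homomorphism from $(\mathbb F_{q^n},+)$ to $\mathbb C^*$. *)

theory Defs
  imports Complex_Main "HOL-Computational_Algebra.Computational_Algebra" "HOL-Library.Cardinality"
begin

definition permutation_polynomial :: "'a::finite_field poly \<Rightarrow> bool" where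
  "permutation_polynomial f \<longleftrightarrow> bij (poly f)"

(* The condition chi x \<noteq> 0 says that the values lie in the multiplicative group of \<complex>. *)
definition additive_character :: "('a::finite_field \<Rightarrow> complex) \<Rightarrow> bool" where
  "additive_character \<chi> \<longleftrightarrow>
     (\<forall>x. \<chi> x \<noteq> 0) \<and> (\<forall>x y. \<chi> (x + y) = \<chi> x * \<chi> y)"

definition nontrivial_additive_character :: "('a::finite_field \<Rightarrow> complex) \<Rightarrow> bool" where
  "nontrivial_additive_character \<chi> \<longleftrightarrow> additive_character \<chi> \<and> (\<exists>x. \<chi> x \<noteq> 1)"

end

(* If f misses the value a, then the double sum of chi (u * (f v - a)) over all u and v vanishes
   by orthogonality in u. Summing over v first, every u \<noteq> 0 contributes 0 by hypothesis and
   u = 0 contributes the size of the field, a contradiction. So f is surjective, hence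
   bijective. *)
theory Submission
  imports Defs
begin

lemma additive_character_0:
  assumes "additive_character \<chi>"
  shows "\<chi> 0 = 1"
proof -
  have "\<chi> 0 * \<chi> 0 = \<chi> 0" "\<chi> 0 \<noteq> 0"
    using assms unfolding additive_character_def by (metis add_0)+
  then show ?thesis by simp
qed

text \<open>Translating by some \<open>b\<close> with \<open>\<chi> b \<noteq> 1\<close> permutes
  the field and multiplies the sum by \<open>\<chi> b\<close>, so the sum must vanish.\<close>

lemma sum_nontrivial_additive_character:
  assumes "nontrivial_additive_character \<chi>"
  shows "(\<Sum>x\<in>UNIV. \<chi> x) = 0"
proof -
  obtain b where b: "\<chi> b \<noteq> 1" and add: "\<And>x y. \<chi> (x + y) = \<chi> x * \<chi> y"
    using assms unfolding nontrivial_additive_character_def additive_character_def by blast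
  have "bij (\<lambda>x. b + x)" by (rule bij_plus)
  then have "(\<Sum>x\<in>UNIV. \<chi> x) = (\<Sum>x\<in>UNIV. \<chi> (b + x))"
    by (rule sum.reindex_bij_betw [symmetric])
  also have "\<dots> = \<chi> b * (\<Sum>x\<in>UNIV. \<chi> x)"
    by (simp add: add sum_distrib_left)
  finally show ?thesis using b by simp
qed

lemma sum_nontrivial_additive_character_mult:
  assumes "nontrivial_additive_character \<chi>" and "c \<noteq> 0"
  shows "(\<Sum>x\<in>UNIV. \<chi> (c * x)) = 0"
proof -
  have "inj (\<lambda>x. c * x)" using assms(2) by (simp add: inj_on_def)
  then have "bij (\<lambda>x. c * x)" by (simp add: bij_def finite_UNIV_inj_surj)
  then have "(\<Sum>x\<in>UNIV. \<chi> (c * x)) = (\<Sum>x\<in>UNIV. \<chi> x)"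
    by (rule sum.reindex_bij_betw)
  then show ?thesis using sum_nontrivial_additive_character [OF assms(1)] by simp
qed

text \<open>Only the values of \<open>g\<close> enter the argument, so it is carried out for an
  arbitrary function rather than a polynomial.\<close>

lemma surj_if_character_sums_zero:
  fixes g :: "'a::finite_field \<Rightarrow> 'a"
  assumes \<chi>: "nontrivial_additive_character \<chi>"
    and zero: "\<And>u. u \<noteq> 0 \<Longrightarrow> (\<Sum>v\<in>UNIV. \<chi> (u * g v)) = 0"
  shows "surj g"
proof (rule ccontr)
  assume "\<not> surj g"
  \<comment> \<open>\<open>a\<close> is a value missed by \<open>g\<close>; in this form each
    \<open>g v - a\<close> can serve as the nonzero multiplier in the orthogonality
    relation.\<close>
  then obtain a where a: "\<And>v. g v - a \<noteq> 0" by (metis eq_iff_diff_eq_0 surjI)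
  have char: "additive_character \<chi>"
    using \<chi> by (simp add: nontrivial_additive_character_def)
  have "(\<Sum>v\<in>UNIV. \<chi> (u * (g v - a))) = (if u = 0 then of_nat CARD('a) else 0)" for u
  proof (cases "u = 0")
    case True
    then show ?thesis by (simp add: additive_character_0 [OF char])
  next
    case False
    \<comment> \<open>The second factor is independent of \<open>v\<close>, so it leaves the sum
      over \<open>v\<close> and the hypothesis \<open>zero\<close> applies.\<close>
    have "\<chi> (u * (g v - a)) = \<chi> (u * g v) * \<chi> (- (u * a))" for v
      using char unfolding additive_character_def
      by (metis diff_conv_add_uminus right_diff_distrib)
    then show ?thesis using False zero by (simp flip: sum_distrib_right)
  qed
  then have "(\<Sum>u\<in>UNIV. \<Sum>v\<in>UNIV. \<chi> (u * (g v - a))) = of_nat CARD('a)"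
    by simp
  moreover have "(\<Sum>v\<in>UNIV. \<Sum>u\<in>UNIV. \<chi> (u * (g v - a))) = 0"
    using sum_nontrivial_additive_character_mult [OF \<chi> a] by (simp add: mult.commute)
  ultimately show False
    \<comment> \<open>Exchanging the sums gives \<open>of_nat CARD('a) = 0\<close> in the complex
      numbers, which is impossible in characteristic 0.\<close>
    by (subst (asm) sum.swap) simp
qed

theorem theorem1:
  fixes n :: nat
    and \<chi> :: "'a::finite_field \<Rightarrow> complex"
    and f :: "'a poly"
  assumes "CHAR('q::finite_field) = 2"
    and "n > 0"
    and "CARD('a) = CARD('q) ^ n"
    and "nontrivial_additive_character \<chi>"
  shows "permutation_polynomial f \<longleftrightarrow>
           (\<forall>u::'a. u \<noteq> 0 \<longrightarrow> (\<Sum>v\<in>UNIV. \<chi> (u * poly f v)) = 0)"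
proof
  assume "permutation_polynomial f"
  then have "bij (poly f)" by (simp add: permutation_polynomial_def)
  \<comment> \<open>Substituting \<open>x = poly f v\<close> reduces the sum to that of the
    character \<open>\<lambda>x. \<chi> (u * x)\<close>, which is nontrivial for
    \<open>u \<noteq> 0\<close>.\<close>
  then have "(\<Sum>v\<in>UNIV. \<chi> (u * poly f v)) = (\<Sum>x\<in>UNIV. \<chi> (u * x))" for u
    by (rule sum.reindex_bij_betw)
  then show "\<forall>u::'a. u \<noteq> 0 \<longrightarrow> (\<Sum>v\<in>UNIV. \<chi> (u * poly f v)) = 0"
    using sum_nontrivial_additive_character_mult [OF assms(4)] by simp
next
  assume "\<forall>u::'a. u \<noteq> 0 \<longrightarrow> (\<Sum>v\<in>UNIV. \<chi> (u * poly f v)) = 0"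
  then have "surj (poly f)"
    using surj_if_character_sums_zero [OF assms(4)] by blast
  then show "permutation_polynomial f"
    by (simp add: permutation_polynomial_def bij_def finite_UNIV_surj_inj)
qed

end
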